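(* Let $A, B$ be alphabets, let $S$ be a semigroup, and let $\varphi : A^{+} \to S$, $\psi : B^{+} \to S$ be two epimorphisms. If the fiber product $\Pi(\varphi,\psi) = \{(u,v) \in A^{+}\times B^{+} : \varphi(u) = \psi(v)\}$ is finitely generated (as a semigroup), then $S$ is $\mathcal{J}$-trivial.
   Context: For an alphabet $A$, $A^{+}$ is the free semigroup of non-empty finite words over $A$ under concatenation. "Epimorphism" means surjective homomorphism. $\Pi(\varphi,\psi)$ is a subsemigroup of the direct product $A^{+}\times B^{+}$. $S^{1}$ denotes $S$ if $S$ has an identity, and otherwise $S$ with an identity $1$ adjoined. Green's relation $\mathcal{J}$ on $S$ is given by $(s,t) \in \mathcal{J}$ iff there exist $x,x',y,y' \in S^{1}$ with $s = xty$ and $t = x'sy'$. $S$ is $\mathcal{J}$-trivial if $\mathcal{J} = \{(s,s) : s \in S\}$. *)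

theory Defs
  imports Main
begin

definition free_semigroup :: "'a set \<Rightarrow> 'a list set" where
  "free_semigroup A = lists A - {[]}"

definition word_epimorphism :: "'a set \<Rightarrow> ('a list \<Rightarrow> 's::semigroup_mult) \<Rightarrow> bool" where
  "word_epimorphism A \<phi> \<longleftrightarrow>
     (\<forall>u\<in>free_semigroup A. \<forall>v\<in>free_semigroup A. \<phi> (u @ v) = \<phi> u * \<phi> v) \<and>
     \<phi> ` free_semigroup A = UNIV"

definition fiber_product ::
  "'a set \<Rightarrow> 'b set \<Rightarrow> ('a list \<Rightarrow> 's) \<Rightarrow> ('b list \<Rightarrow> 's) \<Rightarrow> ('a list \<times> 'b list) set" where
  "fiber_product A B \<phi> \<psi> =
     {(u, v) \<in> free_semigroup A \<times> free_semigroup B. \<phi> u = \<psi> v}"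

definition pair_append :: "'a list \<times> 'b list \<Rightarrow> 'a list \<times> 'b list \<Rightarrow> 'a list \<times> 'b list" where
  "pair_append p q = (fst p @ fst q, snd p @ snd q)"

inductive_set generated_subsemigroup :: "('m \<Rightarrow> 'm \<Rightarrow> 'm) \<Rightarrow> 'm set \<Rightarrow> 'm set"
  for f :: "'m \<Rightarrow> 'm \<Rightarrow> 'm" and G :: "'m set" where
  generator: "x \<in> G \<Longrightarrow> x \<in> generated_subsemigroup f G"
| product: "x \<in> generated_subsemigroup f G \<Longrightarrow> y \<in> generated_subsemigroup f G
    \<Longrightarrow> f x y \<in> generated_subsemigroup f G"

definition finitely_generated_semigroup :: "('m \<Rightarrow> 'm \<Rightarrow> 'm) \<Rightarrow> 'm set \<Rightarrow> bool" where
  "finitely_generated_semigroup f T \<longleftrightarrow>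
     (\<exists>G. finite G \<and> G \<subseteq> T \<and> generated_subsemigroup f G = T)"

text \<open>The monoid S^1: an element s of S is represented by Some s, and None is the adjoined
  identity, present only when S has no identity of its own.\<close>

definition S1 :: "'s::semigroup_mult option set" where
  "S1 = (if \<exists>e::'s. \<forall>x. e * x = x \<and> x * e = x then range Some else UNIV)"

fun mult1 :: "'s::semigroup_mult option \<Rightarrow> 's option \<Rightarrow> 's option" (infixl "\<odot>" 70) where
  "None \<odot> y = y"
| "Some s \<odot> None = Some s"
| "Some s \<odot> Some t = Some (s * t)"

definition green_J :: "('s::semigroup_mult \<times> 's) set" where
  "green_J = {(s, t). \<exists>x\<in>S1. \<exists>x'\<in>S1. \<exists>y\<in>S1. \<exists>y'\<in>S1.
     Some s = x \<odot> Some t \<odot> y \<and> Some t = x' \<odot> Some s \<odot> y'}"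

definition J_trivial :: "'s::semigroup_mult itself \<Rightarrow> bool" where
  "J_trivial _ \<longleftrightarrow> (green_J :: ('s \<times> 's) set) = Id"

end

theory Submission
  imports Defs
begin

text \<open>Let \<open>K\<close> bound the lengths of the first components of finitely many generators of the
  fiber product. A second component is a nonempty word, so a pair \<open>(u, v)\<close> is a product of at
  most \<open>length v\<close> generators, and hence \<open>length u \<le> K * length v\<close>
  (\<open>length_fst_le_of_generated\<close>). Fixing \<open>v\<close>, one sees that every element of \<open>S\<close> has
  preimages under \<open>\<phi>\<close> of bounded length only (\<open>bounded_preimages\<close>).

  On the other hand, an equation \<open>s = p s q\<close> in which \<open>p\<close> or \<open>q\<close> is a genuine element of
  \<open>S\<close> can be pumped: \<open>s = p\<^sup>n s q\<^sup>n\<close> yields preimages of \<open>s\<close> of unbounded length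
  (\<open>long_preimages\<close>). So in such an equation both factors are the adjoined identity. If
  \<open>s = x t y\<close> and \<open>t = x' s y'\<close>, then \<open>s = (x x') s (y' y)\<close>, so all four multipliers are
  the adjoined identity and \<open>s = t\<close>.\<close>

lemma length_fst_le_of_generated:
  assumes "p \<in> generated_subsemigroup pair_append G"
    and "\<And>g. g \<in> G \<Longrightarrow> length (fst g) \<le> K" and "\<And>g. g \<in> G \<Longrightarrow> snd g \<noteq> []"
  shows "length (fst p) \<le> K * length (snd p)"
  using assms(1)
proof induction
  case (generator g)
  then have "1 \<le> length (snd g)"
    using assms(3) by (simp add: Suc_le_eq)
  then have "K * 1 \<le> K * length (snd g)"
    by (rule mult_le_mono2)
  with assms(2)[OF generator] show ?case
    by linarith
next
  case (product p q)
  then show ?case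
    by (simp add: pair_append_def distrib_left)
qed

lemma bounded_preimages:
  assumes \<psi>: "word_epimorphism B \<psi>"
    and fg: "finitely_generated_semigroup pair_append (fiber_product A B \<phi> \<psi>)"
  shows "\<exists>N. \<forall>u\<in>free_semigroup A. \<phi> u = s \<longrightarrow> length u \<le> N"
proof -
  obtain G where G: "finite G" "G \<subseteq> fiber_product A B \<phi> \<psi>"
    and gen: "generated_subsemigroup pair_append G = fiber_product A B \<phi> \<psi>"
    using fg unfolding finitely_generated_semigroup_def by blast
  obtain K where K: "\<And>g. g \<in> G \<Longrightarrow> length (fst g) \<le> K"
    using finite_imageI[OF G(1), of "\<lambda>g. length (fst g)"]
    unfolding finite_nat_set_iff_bounded_le by blast
  have nonempty: "\<And>g. g \<in> G \<Longrightarrow> snd g \<noteq> []"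
    using G(2) by (auto simp: fiber_product_def free_semigroup_def)
  have "s \<in> \<psi> ` free_semigroup B"
    using \<psi> by (simp add: word_epimorphism_def)
  then obtain v where v: "v \<in> free_semigroup B" "\<psi> v = s"
    by blast
  have "length u \<le> K * length v" if "u \<in> free_semigroup A" "\<phi> u = s" for u
  proof -
    have "(u, v) \<in> generated_subsemigroup pair_append G"
      using that v by (simp add: gen fiber_product_def)
    from length_fst_le_of_generated[OF this K nonempty] show ?thesis
      by simp
  qed
  then show ?thesis
    by blast
qed

lemma mult1_assoc: "(x \<odot> y) \<odot> z = x \<odot> (y \<odot> z)"
  by (cases x; cases y; cases z) (simp_all add: mult.assoc)

lemma mult1_eq_None_iff: "x \<odot> y = None \<longleftrightarrow> x = None \<and> y = None"
  by (cases x; cases y) simp_all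

text \<open>Substituting \<open>s = p s q\<close> into itself lengthens a preimage by at least one letter each
  time, since a genuine factor has a nonempty preimage.\<close>
lemma long_preimages:
  assumes \<phi>: "word_epimorphism A \<phi>"
    and eq: "Some s = p \<odot> Some s \<odot> q" and genuine: "p \<noteq> None \<or> q \<noteq> None"
  shows "\<exists>u\<in>free_semigroup A. \<phi> u = s \<and> n \<le> length u"
proof -
  have surj: "\<exists>w\<in>free_semigroup A. \<phi> w = t" for t
  proof -
    have "t \<in> \<phi> ` free_semigroup A"
      using \<phi> by (simp add: word_epimorphism_def)
    then show ?thesis
      by blast
  qed
  have hom: "u @ v \<in> free_semigroup A \<and> \<phi> (u @ v) = \<phi> u * \<phi> v
      \<and> Suc (length u) \<le> length (u @ v) \<and> Suc (length v) \<le> length (u @ v)"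
    if "u \<in> free_semigroup A" "v \<in> free_semigroup A" for u v
    using \<phi> that by (auto simp: word_epimorphism_def free_semigroup_def Suc_le_eq)
  show ?thesis
  proof (induction n)
    case 0
    show ?case
      using surj[of s] by auto
  next
    case (Suc n)
    then obtain u where u: "u \<in> free_semigroup A" "\<phi> u = s" "n \<le> length u"
      by blast
    show ?case
    proof (cases p)
      case None
      with genuine obtain b where q: "q = Some b"
        by blast
      obtain w where "w \<in> free_semigroup A" "\<phi> w = b"
        using surj by blast
      with hom[of u w] u eq None q show ?thesis
        by (intro bexI[of _ "u @ w"]) auto
    next
      case (Some a)
      obtain w where w: "w \<in> free_semigroup A" "\<phi> w = a"
        using surj by blast
      with hom[of w u] u have wu: "w @ u \<in> free_semigroup A" "\<phi> (w @ u) = a * s"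
        "Suc n \<le> length (w @ u)"
        by auto
      show ?thesis
      proof (cases q)
        case None
        with wu eq Some show ?thesis
          by (intro bexI[of _ "w @ u"]) auto
      next
        case q: (Some b)
        obtain z where "z \<in> free_semigroup A" "\<phi> z = b"
          using surj by blast
        with hom[of "w @ u" z] wu eq Some q show ?thesis
          by (intro bexI[of _ "(w @ u) @ z"]) auto
      qed
    qed
  qed
qed

lemma green_J_refl: "(s, s) \<in> green_J"
proof (cases "\<exists>e::'a. \<forall>x. e * x = x \<and> x * e = x")
  case True
  then obtain e :: 'a where "\<forall>x. e * x = x \<and> x * e = x"
    by blast
  then have "Some s = Some e \<odot> Some s \<odot> Some e"
    by simp
  moreover have "Some e \<in> S1"
    using True by (simp add: S1_def)
  ultimately show ?thesis
    unfolding green_J_def by blast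
next
  case False
  then have "(None :: 'a option) \<in> S1"
    unfolding S1_def by (simp only: if_False UNIV_I)
  moreover have "Some s = None \<odot> Some s \<odot> None"
    by simp
  ultimately show ?thesis
    unfolding green_J_def by blast
qed

theorem proposition4p5:
  fixes A :: "'a set" and B :: "'b set"
    and \<phi> :: "'a list \<Rightarrow> 's::semigroup_mult" and \<psi> :: "'b list \<Rightarrow> 's"
  assumes "word_epimorphism A \<phi>"
    and "word_epimorphism B \<psi>"
    and "finitely_generated_semigroup pair_append (fiber_product A B \<phi> \<psi>)"
  shows "J_trivial TYPE('s)"
proof -
  have no_genuine_factor: "p = None \<and> q = None"
    if eq: "Some s = p \<odot> Some s \<odot> q" for s :: 's and p q :: "'s option"
  proof (rule ccontr)
    assume "\<not> (p = None \<and> q = None)"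
    then have genuine: "p \<noteq> None \<or> q \<noteq> None"
      by simp
    obtain N where N: "\<forall>u\<in>free_semigroup A. \<phi> u = s \<longrightarrow> length u \<le> N"
      using bounded_preimages[OF assms(2,3)] by blast
    obtain u where "u \<in> free_semigroup A" "\<phi> u = s" "Suc N \<le> length u"
      using long_preimages[OF assms(1) eq genuine] by blast
    with N show False
      by fastforce
  qed
  have "s = t" if "(s, t) \<in> green_J" for s t :: 's
  proof -
    from that obtain x x' y y' where s: "Some s = x \<odot> Some t \<odot> y"
      and t: "Some t = x' \<odot> Some s \<odot> y'"
      unfolding green_J_def by blast
    have "Some s = (x \<odot> x') \<odot> Some s \<odot> (y' \<odot> y)"
      using s unfolding t by (simp only: mult1_assoc)
    from no_genuine_factor[OF this] have "x = None" "y = None"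
      by (simp_all add: mult1_eq_None_iff)
    with s show ?thesis
      by simp
  qed
  then show ?thesis
    unfolding J_trivial_def using green_J_refl by auto
qed

end
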